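(* Let $P \subset \mathbb{R}^n$ be a regular $n$-dimensional (convex) polytope with vertices $v_1,\dots,v_V$ and edge length $\ell$, and let $\delta_\parallel$ be the maximum length of a vector joining two distinct vertices of $P$ that is parallel to some edge of $P$. Then the optimal ratio of the Generalized Chaos Game on $P$ is $$r_{\mathrm{opt}} = \frac{\delta_\parallel}{\delta_\parallel + \ell}.$$ That is, for $r\in(0,1)$, the regions $w_i(P) = \{(1-r)x + r v_i : x \in P\}$, $i=1,\dots,V$, touch without overlapping if and only if $r = \frac{\delta_\parallel}{\delta_\parallel+\ell}$.
   Context: The Generalized Chaos Game on $P$ with ratio $r\in(0,1)$ generates points in $\mathbb{R}^n$ by $x_{c+1} = (1-r)x_c + r v_i$, where at each step $v_i$ is a randomly chosen vertex of $P$. For each vertex $v_i$, let $w_i:\mathbb{R}^n\to\mathbb{R}^n$, $w_i(x) = (1-r)x + r v_i$. The self-similar regions are the scaled copies $w_1(P),\dots,w_V(P)$ of the solid polytope $P$, one per vertex. The regions touch without overlapping if (a) no point of one region lies in the interior of a different region, i.e. $w_j(P)\cap \operatorname{int} w_i(P) = \emptyset$ for all $i\neq j$ (they may share boundary points, such as vertices), and (b) they do touch, i.e. $w_i(P)\cap w_j(P)\neq\emptyset$ for some $i\ne j$. The optimal ratio $r_{\mathrm{opt}}$ is the ratio $r\in(0,1)$ at which the regions touch without overlapping. Let $\mathcal{A}$ be the set of vectors between pairs of distinct vertices of $P$, with one vector (of either orientation) for each unordered pair, and let $\mathcal{B}\subseteq\mathcal{A}$ be the subset of those vectors joining the endpoints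 of an edge of $P$; all vectors in $\mathcal{B}$ have length $\ell$. Two nonzero vectors $\vec u,\vec v$ are parallel, written $\vec u\parallel\vec v$, if $\vec u=\lambda\vec v$ for some real constant $\lambda$. Then $$\delta_\parallel := \max\{|\vec u| : \vec u\in\mathcal{A},\ \vec u\parallel\vec v \text{ for some } \vec v\in\mathcal{B}\}.$$ *)

theory Defs
  imports "HOL-Analysis.Analysis"
begin

definition vertices_of :: "'a::euclidean_space set \<Rightarrow> 'a set" where
  "vertices_of P = {x. x extreme_point_of P}"

text \<open>
  Complete flags, as in the theory of regular polytopes: a nested sequence of faces, one in
  each dimension. We index up to the dimension of \<open>P\<close> itself, so the last face is \<open>P\<close>.
\<close>
definition flag_of :: "(nat \<Rightarrow> 'a::euclidean_space set) \<Rightarrow> 'a set \<Rightarrow> bool" where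
  "flag_of F P \<longleftrightarrow>
     (\<forall>i. int i \<le> aff_dim P \<longrightarrow> F i face_of P \<and> aff_dim (F i) = int i) \<and>
     (\<forall>i. int (Suc i) \<le> aff_dim P \<longrightarrow> F i \<subseteq> F (Suc i))"

text \<open>Symmetries are isometries of the ambient space, orientation-reversing ones included.\<close>
definition symmetry_of :: "('a::euclidean_space \<Rightarrow> 'a) \<Rightarrow> 'a set \<Rightarrow> bool" where
  "symmetry_of f P \<longleftrightarrow> (\<forall>x y. dist (f x) (f y) = dist x y) \<and> f ` P = P"

definition regular_polytope :: "'a::euclidean_space set \<Rightarrow> bool" where
  "regular_polytope P \<longleftrightarrow>
     polytope P \<and>
     (\<forall>F G. flag_of F P \<and> flag_of G P \<longrightarrow>
        (\<exists>f. symmetry_of f P \<and> (\<forall>i. int i \<le> aff_dim P \<longrightarrow> f ` F i = G i)))"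

definition edge_length :: "'a::euclidean_space set \<Rightarrow> real \<Rightarrow> bool" where
  "edge_length P l \<longleftrightarrow> (\<forall>a b. closed_segment a b edge_of P \<longrightarrow> dist a b = l)"

text \<open>
  Both orientations of each vector are included in the next two sets; lengths and parallelism
  do not depend on the orientation.
\<close>
definition vertex_vectors :: "'a::euclidean_space set \<Rightarrow> 'a set" where
  "vertex_vectors P = {b - a | a b. a \<in> vertices_of P \<and> b \<in> vertices_of P \<and> a \<noteq> b}"

definition edge_vectors :: "'a::euclidean_space set \<Rightarrow> 'a set" where
  "edge_vectors P = {b - a | a b. a \<in> vertices_of P \<and> b \<in> vertices_of P \<and> a \<noteq> b \<and>
                                 closed_segment a b edge_of P}"

definition parallel :: "'a::real_vector \<Rightarrow> 'a \<Rightarrow> bool" where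
  "parallel u v \<longleftrightarrow> u \<noteq> 0 \<and> v \<noteq> 0 \<and> (\<exists>c::real. u = c *\<^sub>R v)"

definition delta_par :: "'a::euclidean_space set \<Rightarrow> real" where
  "delta_par P = Max {norm u | u. u \<in> vertex_vectors P \<and> (\<exists>v \<in> edge_vectors P. parallel u v)}"

definition chaos_map :: "real \<Rightarrow> 'a::real_vector \<Rightarrow> 'a \<Rightarrow> 'a" where
  "chaos_map r p x = (1 - r) *\<^sub>R x + r *\<^sub>R p"

definition touch_without_overlapping ::
    "'i set \<Rightarrow> ('i \<Rightarrow> 'a::topological_space set) \<Rightarrow> bool" where
  "touch_without_overlapping I R \<longleftrightarrow>
     (\<forall>i\<in>I. \<forall>j\<in>I. i \<noteq> j \<longrightarrow> R j \<inter> interior (R i) = {}) \<and>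
     (\<exists>i\<in>I. \<exists>j\<in>I. i \<noteq> j \<and> R i \<inter> R j \<noteq> {})"

definition is_optimal_ratio ::
    "'a::euclidean_space set \<Rightarrow> 'i set \<Rightarrow> ('i \<Rightarrow> 'a) \<Rightarrow> real \<Rightarrow> bool" where
  "is_optimal_ratio P I v r \<longleftrightarrow>
     0 < r \<and> r < 1 \<and> touch_without_overlapping I (\<lambda>i. chaos_map r (v i) ` P)"

end

theory Submission
  imports Defs
begin

text \<open>
  Write \<open>t = r / (1 - r)\<close>. The point of the region of a vertex \<open>a\<close> that comes from \<open>p \<in> P\<close> equals the
  point of the region of \<open>b\<close> that comes from \<open>q \<in> P\<close> exactly when \<open>p - q = t (b - a)\<close>. So everything depends on
  how far the vectors between vertices can be stretched before they cease to be vectors between points of \<open>P\<close>. The claim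
  is that the critical stretching factor is \<open>\<delta> / l\<close>, where \<open>\<delta>\<close> is \<open>delta_par P\<close>, and that it is reached
  by an edge. No classification of the regular polytopes is used; there are three ingredients.

  Reflections. For an edge \<open>a a'\<close>, two flags that differ only in the vertex \<open>a\<close> or \<open>a'\<close> are related
  by a symmetry. It swaps \<open>a\<close> and \<open>a'\<close> and fixes the barycenters of all larger faces of the flag, so it is
  the reflection in the perpendicular bisector of the edge (\<open>edge_bisector_reflection_symmetry\<close>). Hence the
  width of \<open>P\<close> in the direction of the edge is the length of a chord between a vertex and its mirror
  image. This chord is parallel to the edge, so the width is at most \<open>\<delta>\<close> (\<open>edge_vector_width\<close>).

  Approaching a vertex along edges. The vertices lie on a sphere, so on them the squared distance to a
  vertex \<open>b\<close> agrees with an affine function. As in the simplex algorithm, each vertex \<open>a \<noteq> b\<close>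
  has a neighbour \<open>a'\<close> that is closer to \<open>b\<close> (\<open>closer_neighbour\<close>). Applied to a pair at minimal
  distance, this shows that distinct vertices are at least \<open>l\<close> apart (\<open>edge_length_le_vertex_dist\<close>).

  Separation. For \<open>a \<noteq> b\<close> take such a neighbour \<open>a'\<close>. The vertex \<open>b\<close> lies on the side of \<open>a'\<close> of the bisector of
  \<open>a a'\<close>, and its mirror image is another vertex, at distance at least \<open>l\<close>. Thus \<open>b\<close> is at distance
  at least \<open>l / 2\<close> from the bisector, which says that \<open>b - a\<close> has component at least \<open>l\<close> along the edge
  (\<open>edge_separating_vertices\<close>).

  Together: if \<open>p - q = t (b - a)\<close> with \<open>p, q \<in> P\<close>, then along this edge the left-hand side has component at
  most \<open>\<delta>\<close> and the right-hand side at least \<open>t l\<close>. So the regions cannot meet for \<open>t l > \<delta>\<close>, and cannot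
  overlap for \<open>t l = \<delta>\<close>. Conversely, a chord of length \<open>\<delta>\<close> parallel to an edge makes the regions of the
  endpoints of that edge meet for \<open>t l = \<delta>\<close>, and shrinking it into the interior makes them overlap for
  \<open>t l < \<delta>\<close>. Solving \<open>t l = \<delta>\<close> for \<open>r\<close> gives the stated ratio.
\<close>

section \<open>Isometries and barycenters\<close>

text \<open>
  The average of the vertices, not the center of mass of the solid polytope: a symmetry permutes the vertices and so
  visibly fixes it.
\<close>
definition barycenter :: "'a::euclidean_space set \<Rightarrow> 'a" where
  "barycenter F = (\<Sum>x\<in>vertices_of F. x) /\<^sub>R real (card (vertices_of F))"

lemma isometry_linear_part:
  fixes f :: "'a::euclidean_space \<Rightarrow> 'a"
  assumes "\<And>x y. dist (f x) (f y) = dist x y"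
  obtains g c where "linear g" "inj g" "\<And>x. f x = g x + c"
proof
  define g where "g x = f x - f 0" for x
  have "orthogonal_transformation g"
    unfolding orthogonal_transformation_isometry g_def using assms by (simp add: dist_norm)
  then show "linear g" "inj g"
    using orthogonal_transformation_linear orthogonal_transformation_inj by blast+
  show "f x = g x + f 0" for x by (simp add: g_def)
qed

lemma symmetry_of_vertices:
  assumes "symmetry_of f P"
  shows "f ` vertices_of P = vertices_of P" "inj f"
proof -
  have iso: "\<And>x y. dist (f x) (f y) = dist x y" and im: "f ` P = P"
    using assms by (auto simp: symmetry_of_def)
  show inj: "inj f"
    using iso by (metis dist_eq_0_iff injI)
  obtain g c where g: "linear g" "inj g" "\<And>x. f x = g x + c"
    by (rule isometry_linear_part[OF iso], rule that)
  have seg: "open_segment (f a) (f b) = f ` open_segment a b" for a b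
  proof -
    have "f ` S = (+) c ` g ` S" for S using g(3) by (force simp: image_iff add.commute)
    moreover have "open_segment (f a) (f b) = open_segment (c + g a) (c + g b)"
      using g(3)[of a] g(3)[of b] by (simp add: add.commute)
    ultimately show ?thesis
      by (simp add: open_segment_translation open_segment_linear_image[OF g(1,2)])
  qed
  have ext: "f x extreme_point_of P \<longleftrightarrow> x extreme_point_of P" for x
  proof -
    have "f x extreme_point_of f ` P \<longleftrightarrow> x extreme_point_of P"
      unfolding extreme_point_of_def using inj by (auto simp: seg inj_image_mem_iff)
    then show ?thesis by (simp add: im)
  qed
  show "f ` vertices_of P = vertices_of P"
  proof (intro equalityI subsetI)
    fix y assume y: "y \<in> vertices_of P"
    then have "y \<in> f ` P" by (simp add: im vertices_of_def extreme_point_of_def)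
    with y ext show "y \<in> f ` vertices_of P" by (auto simp: vertices_of_def)
  qed (auto simp: vertices_of_def ext)
qed

lemma polytope_vertices:
  assumes "polytope P"
  shows "finite (vertices_of P)" "P = convex hull vertices_of P"
  using assms finite_polyhedron_extreme_points polytope_imp_polyhedron
    Krein_Milman_Minkowski polytope_imp_compact polytope_imp_convex
  unfolding vertices_of_def by blast+

lemma polytope_vertices_nonempty:
  assumes "polytope P" "P \<noteq> {}"
  shows "card (vertices_of P) > 0"
  using polytope_vertices[OF assms(1)] assms(2) by (metis card_gt_0_iff convex_hull_empty)

lemma inner_barycenter:
  "h \<bullet> barycenter F = (\<Sum>x\<in>vertices_of F. h \<bullet> x) / card (vertices_of F)"
  by (simp add: barycenter_def inner_sum_right divide_inverse mult.commute)

lemma symmetry_of_barycenter: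
  assumes "symmetry_of f F" "polytope F" "F \<noteq> {}"
  shows "f (barycenter F) = barycenter F"
proof -
  let ?V = "vertices_of F"
  have iso: "\<And>x y. dist (f x) (f y) = dist x y"
    using assms(1) by (simp add: symmetry_of_def)
  obtain g c where g: "linear g" "inj g" "\<And>x. f x = g x + c"
    by (rule isometry_linear_part[OF iso], rule that)
  have "(\<Sum>x\<in>?V. x) = (\<Sum>x\<in>f ` ?V. x)"
    using symmetry_of_vertices(1)[OF assms(1)] by simp
  also have "\<dots> = (\<Sum>x\<in>?V. f x)"
    using symmetry_of_vertices(2)[OF assms(1)] by (subst sum.reindex) (auto intro: inj_on_subset)
  also have "\<dots> = (\<Sum>x\<in>?V. g x + c)"
    by (rule sum.cong[OF refl]) (rule g(3))
  also have "\<dots> = g (\<Sum>x\<in>?V. x) + real (card ?V) *\<^sub>R c"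
    by (simp add: sum.distrib linear_sum[OF g(1)] sum_constant_scaleR)
  finally have eq: "(\<Sum>x\<in>?V. x) = g (\<Sum>x\<in>?V. x) + real (card ?V) *\<^sub>R c" .
  have "barycenter F = (g (\<Sum>x\<in>?V. x) + real (card ?V) *\<^sub>R c) /\<^sub>R real (card ?V)"
    unfolding barycenter_def by (simp only: flip: eq)
  also have "\<dots> = g (barycenter F) + c"
    using polytope_vertices_nonempty[OF assms(2,3)]
    by (simp add: barycenter_def linear_cmul[OF g(1)] scaleR_right_distrib)
  finally have "barycenter F = g (barycenter F) + c" .
  with g(3) show ?thesis by metis
qed

lemma barycenter_in_polytope:
  assumes "polytope F" "F \<noteq> {}"
  shows "barycenter F \<in> F"
proof -
  let ?V = "vertices_of F"
  have V: "card ?V > 0" "finite ?V" "?V \<subseteq> F"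
    using polytope_vertices_nonempty[OF assms] polytope_vertices[OF assms(1)]
    by (auto simp: vertices_of_def extreme_point_of_def)
  have "(\<Sum>x\<in>?V. (1 / card ?V) *\<^sub>R x) \<in> F"
    using V polytope_imp_convex[OF assms(1)] by (intro convex_sum) auto
  then show ?thesis
    by (simp add: barycenter_def scaleR_sum_right divide_inverse)
qed

text \<open>
  A supporting functional of the face attains its maximum at an average of all vertices, hence at each of
  them. This makes the barycenters along a flag affinely independent.
\<close>
lemma face_containing_barycenter:
  assumes "polytope F" "G face_of F" "barycenter F \<in> G"
  shows "G = F"
proof -
  let ?V = "vertices_of F"
  have ne: "F \<noteq> {}" and GF: "G \<subseteq> F" using assms face_of_imp_subset by blast+
  have V: "card ?V > 0" "finite ?V" "?V \<subseteq> F"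
    using polytope_vertices_nonempty[OF assms(1) ne] polytope_vertices[OF assms(1)]
    by (auto simp: vertices_of_def extreme_point_of_def)
  obtain h \<beta> where h: "F \<subseteq> {x. h \<bullet> x \<le> \<beta>}" "G = F \<inter> {x. h \<bullet> x = \<beta>}"
    using exposed_face_of_polyhedron[OF polytope_imp_polyhedron[OF assms(1)]] assms(2)
    unfolding exposed_face_of_def by metis
  have "(\<Sum>x\<in>?V. h \<bullet> x) / card ?V = \<beta>"
    using assms(3) h(2) by (simp add: inner_barycenter)
  then have "(\<Sum>x\<in>?V. \<beta> - h \<bullet> x) = 0"
    using V(1) by (simp add: sum_subtractf field_simps)
  then have "\<forall>x\<in>?V. \<beta> - h \<bullet> x = 0"
    using V h(1) by (subst (asm) sum_nonneg_eq_0_iff) auto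
  then have "?V \<subseteq> G" using V(3) h(2) by auto
  then have "convex hull ?V \<subseteq> G"
    using face_of_imp_convex[OF assms(2)] polytope_imp_convex[OF assms(1)] hull_minimal by metis
  then show ?thesis using GF polytope_vertices(2)[OF assms(1)] by blast
qed

section \<open>Edges and flags\<close>

text \<open>
  Iterated passage to a facet that contains the given face decreases the dimension one step at a time, so
  it meets every dimension on the way down.
\<close>
lemma face_extension:
  assumes "polytope P" "F face_of P" "F \<noteq> {}" "aff_dim F < aff_dim P"
  shows "\<exists>G. G face_of P \<and> F \<subseteq> G \<and> aff_dim G = aff_dim F + 1"
  using assms
proof (induction "nat (aff_dim P)" arbitrary: P rule: less_induct)
  case less
  have "F \<noteq> P" using less.prems(4) by auto
  then obtain H where H: "H facet_of P" "F \<subseteq> H"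
    using face_of_polyhedron_subset_facet less.prems polytope_imp_polyhedron by metis
  then have Hf: "H face_of P" "aff_dim H = aff_dim P - 1" by (auto simp: facet_of_def)
  have FH: "F face_of H"
    using H(2) Hf(1) less.prems(2) face_of_imp_subset face_of_subset by metis
  have polH: "polytope H" using face_of_polytope_polytope less.prems(1) Hf(1) by blast
  have pos: "aff_dim F \<ge> 0" using less.prems(3) by (metis aff_dim_negative_iff not_le)
  show ?case
  proof (cases "aff_dim F < aff_dim H")
    case True
    then have "\<exists>G. G face_of H \<and> F \<subseteq> G \<and> aff_dim G = aff_dim F + 1"
      using pos Hf(2) FH polH less.prems(3) by (intro less.hyps) auto
    then show ?thesis using face_of_trans Hf(1) by blast
  next
    case False
    then have "aff_dim P = aff_dim F + 1" using Hf(2) less.prems(4) by simp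
    then show ?thesis
      using face_of_refl polytope_imp_convex less.prems(1) face_of_imp_subset less.prems(2) by metis
  qed
qed

lemma edge_endpoints:
  assumes "closed_segment a b edge_of P"
  shows "a \<in> vertices_of P" "b \<in> vertices_of P" "a \<noteq> b"
proof -
  have f: "closed_segment a b face_of P" and d: "aff_dim (closed_segment a b) = 1"
    using assms by (auto simp: edge_of_def)
  show "a \<noteq> b" using d by auto
  show "a \<in> vertices_of P" "b \<in> vertices_of P"
    using extreme_point_of_face[OF f] by (auto simp: vertices_of_def extreme_point_of_segment)
qed

lemma edge_at_vertex:
  assumes "polytope P" "a \<in> vertices_of P" "aff_dim P \<ge> 1"
  obtains b where "closed_segment a b edge_of P"
proof -
  have aP: "{a} face_of P" using assms(2) by (simp add: vertices_of_def face_of_singleton)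
  then obtain G where G: "G face_of P" "a \<in> G" "aff_dim G = 1"
    using face_extension[OF assms(1) aP] assms(3) by auto
  have "polytope G" using G(1) assms(1) face_of_polytope_polytope by blast
  moreover have "collinear G" using G(3) by (simp add: collinear_aff_dim)
  ultimately obtain c d where cd: "G = closed_segment c d"
    using G(2) compact_convex_collinear_segment polytope_imp_compact polytope_imp_convex
    by (metis empty_iff)
  have "a extreme_point_of G" using extreme_point_of_face[OF G(1)] G(2) assms(2)
    by (simp add: vertices_of_def)
  then have "a = c \<or> a = d" by (simp add: cd extreme_point_of_segment)
  then show thesis using that G cd by (metis closed_segment_commute edge_of_def)
qed

text \<open>
  A single chain above the edge serves both flags: they differ in the vertex only.
\<close>
lemma flag_through_edge:
  assumes "polytope P" "closed_segment a b edge_of P"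
  obtains F where "flag_of F P" "F 1 = closed_segment a b"
    "flag_of (F(0 := {a})) P" "flag_of (F(0 := {b})) P"
proof -
  let ?e = "closed_segment a b"
  have e: "?e face_of P" "aff_dim ?e = 1" using assms(2) by (auto simp: edge_of_def)
  \<comment> \<open>The sequence starts at the edge, so its index is the dimension minus one.\<close>
  define good where "good n G \<longleftrightarrow> (n = 0 \<longrightarrow> G = ?e) \<and>
    (int (Suc n) \<le> aff_dim P \<longrightarrow> G face_of P \<and> aff_dim G = int (Suc n))" for n G
  have "\<exists>f. \<forall>n. good n (f n) \<and> (int (Suc (Suc n)) \<le> aff_dim P \<longrightarrow> f n \<subseteq> f (Suc n))"
  proof (rule dependent_nat_choice)
    show "\<exists>G. good 0 G" using e by (auto simp: good_def)
  next
    fix G n assume G: "good n G"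
    show "\<exists>G'. good (Suc n) G' \<and> (int (Suc (Suc n)) \<le> aff_dim P \<longrightarrow> G \<subseteq> G')"
    proof (cases "int (Suc (Suc n)) \<le> aff_dim P")
      case True
      then have G': "G face_of P" "aff_dim G = int (Suc n)" using G by (auto simp: good_def)
      then have "G \<noteq> {}" by auto
      then obtain H where "H face_of P" "G \<subseteq> H" "aff_dim H = aff_dim G + 1"
        using face_extension[OF assms(1) G'(1)] G'(2) True by auto
      then show ?thesis using G'(2) by (intro exI[of _ H]) (auto simp: good_def)
    qed (auto simp: good_def)
  qed
  then obtain f where f: "\<And>n. good n (f n)"
    "\<And>n. int (Suc (Suc n)) \<le> aff_dim P \<Longrightarrow> f n \<subseteq> f (Suc n)" by blast
  define F where "F c = case_nat {c} f" for c
  have flag: "flag_of (F c) P" if "c \<in> {a, b}" for c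
  proof -
    have c: "c extreme_point_of P" "c \<in> ?e"
      using edge_endpoints[OF assms(2)] that by (auto simp: vertices_of_def)
    have f0: "f 0 = ?e" using f(1)[of 0] by (simp add: good_def)
    show ?thesis
      unfolding flag_of_def
    proof (intro conjI allI impI)
      fix i assume i: "int i \<le> aff_dim P"
      show "F c i face_of P" "aff_dim (F c i) = int i"
        using f(1)[of "i - 1"] i c(1) by (auto simp: F_def good_def face_of_singleton split: nat.splits)
    next
      fix i assume i: "int (Suc i) \<le> aff_dim P"
      show "F c i \<subseteq> F c (Suc i)"
        using f(2)[of "i - 1"] i c(2) f0 by (auto simp: F_def split: nat.splits)
    qed
  qed
  show thesis
  proof
    have "(F a)(0 := {c}) = F c" for c by (auto simp: F_def fun_eq_iff split: nat.splits)
    then show "flag_of ((F a)(0 := {a})) P" "flag_of ((F a)(0 := {b})) P"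
      using flag by auto
    show "flag_of (F a) P" using flag by auto
    show "F a 1 = ?e" using f(1)[of 0] by (simp add: F_def good_def)
  qed
qed

section \<open>The reflection in the bisector of an edge\<close>

definition bisector_reflection :: "'a::euclidean_space \<Rightarrow> 'a \<Rightarrow> 'a \<Rightarrow> 'a" where
  "bisector_reflection a b x =
     x - (2 * ((x - midpoint a b) \<bullet> (b - a)) / (norm (b - a))\<^sup>2) *\<^sub>R (b - a)"

lemma inner_midpoint: "midpoint a b \<bullet> (b - a) = (b \<bullet> b - a \<bullet> a) / 2"
  by (simp add: midpoint_def algebra_simps inner_commute)

text \<open>
  If an isometry that swaps \<open>a\<close> and \<open>b\<close> moves \<open>x\<close> parallel to \<open>b - a\<close>, then the distances from its image to \<open>a\<close> and \<open>b\<close>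
  determine by how much.
\<close>
lemma swapping_isometry_eq_bisector_reflection:
  assumes iso: "\<And>x y. dist (f x) (f y) = dist x y"
    and swap: "f a = b" "f b = a" and "a \<noteq> b"
    and par: "\<exists>c. x - f x = c *\<^sub>R (b - a)"
  shows "f x = bisector_reflection a b x"
proof -
  obtain c where c: "x - f x = c *\<^sub>R (b - a)" using par by blast
  have sq: "(p - q) \<bullet> (p - q) = (p' - q') \<bullet> (p' - q')" if "dist p q = dist p' q'" for p q p' q' :: 'a
    using that by (simp add: dist_norm norm_eq)
  have "(f x - b) \<bullet> (f x - b) = (x - a) \<bullet> (x - a)" "(f x - a) \<bullet> (f x - a) = (x - b) \<bullet> (x - b)"
    using iso[of x a] iso[of x b] by (auto simp only: swap intro!: sq)
  then have "(x - f x) \<bullet> (b - a) = 2 * (x \<bullet> (b - a)) - (b \<bullet> b - a \<bullet> a)"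
    by (simp add: algebra_simps inner_commute)
  moreover have "c * (norm (b - a))\<^sup>2 = (x - f x) \<bullet> (b - a)"
    by (simp add: c power2_norm_eq_inner)
  moreover have "2 * ((x - midpoint a b) \<bullet> (b - a)) = 2 * (x \<bullet> (b - a)) - (b \<bullet> b - a \<bullet> a)"
    by (simp only: inner_diff_left[of x] inner_midpoint right_diff_distrib) (simp add: field_simps)
  ultimately have "c * (norm (b - a))\<^sup>2 = 2 * ((x - midpoint a b) \<bullet> (b - a))" by simp
  then have "c = 2 * ((x - midpoint a b) \<bullet> (b - a)) / (norm (b - a))\<^sup>2"
    using \<open>a \<noteq> b\<close> by (simp add: field_simps)
  then show ?thesis
    using c by (simp add: bisector_reflection_def algebra_simps)
qed

lemma symmetry_swapping_edge:
  assumes "regular_polytope P" "closed_segment a b edge_of P" "flag_of F P" "F 1 = closed_segment a b"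
    "flag_of (F(0 := {a})) P" "flag_of (F(0 := {b})) P"
  obtains f where "symmetry_of f P" "f a = b" "f b = a"
    "\<And>i. 1 \<le> i \<Longrightarrow> int i \<le> aff_dim P \<Longrightarrow> f ` F i = F i"
proof -
  have dim: "aff_dim P \<ge> 1"
    using assms(2) aff_dim_subset face_of_imp_subset unfolding edge_of_def by metis
  obtain f where f: "symmetry_of f P"
    "\<And>i. int i \<le> aff_dim P \<Longrightarrow> f ` (F(0 := {a})) i = (F(0 := {b})) i"
    using assms(1,5,6) unfolding regular_polytope_def by metis
  have fa: "f a = b" using f(2)[of 0] dim by simp
  have Fi: "f ` F i = F i" if "1 \<le> i" "int i \<le> aff_dim P" for i
    using f(2)[of i] that by simp
  have "symmetry_of f (closed_segment a b)"
    using f(1) Fi[of 1] dim assms(4) by (simp add: symmetry_of_def)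
  then have im: "f ` {a, b} = {a, b}" and inj: "inj f"
    using symmetry_of_vertices[of f "closed_segment a b"]
    by (auto simp: vertices_of_def extreme_point_of_segment)
  have "a \<noteq> b" using edge_endpoints[OF assms(2)] by simp
  then have "f b = a" using im fa inj by auto
  then show thesis using that f(1) fa Fi by blast
qed

text \<open>
  Consider the points \<open>x\<close> for which \<open>x - f x\<close> is parallel to the edge, where \<open>f\<close> is the symmetry that swaps
  the endpoints and preserves the larger faces of a flag. They form an affine set, which contains the
  edge and the barycenters of the larger faces of the flag. Each barycenter raises the dimension by one,
  so the affine set is the whole space.
\<close>
lemma edge_bisector_reflection_symmetry:
  fixes P :: "'a::euclidean_space set"
  assumes "regular_polytope P" "aff_dim P = int DIM('a)" "closed_segment a b edge_of P"
  shows "symmetry_of (bisector_reflection a b) P"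
proof -
  have pol: "polytope P" using assms(1) by (simp add: regular_polytope_def)
  obtain F where F: "flag_of F P" "F 1 = closed_segment a b"
    "flag_of (F(0 := {a})) P" "flag_of (F(0 := {b})) P"
    using flag_through_edge[OF pol assms(3)] by blast
  obtain f where f: "symmetry_of f P" "f a = b" "f b = a"
    and Fi: "\<And>i. 1 \<le> i \<Longrightarrow> int i \<le> aff_dim P \<Longrightarrow> f ` F i = F i"
    using symmetry_swapping_edge[OF assms(1,3) F] by blast
  have iso: "\<And>x y. dist (f x) (f y) = dist x y" using f(1) by (simp add: symmetry_of_def)
  obtain g t where g: "linear g" "inj g" "\<And>x. f x = g x + t"
    by (rule isometry_linear_part[OF iso], rule that)
  define T where "T = {x. \<exists>c. x - f x = c *\<^sub>R (b - a)}"
  have "affine T"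
    unfolding affine_def
  proof (intro ballI allI impI)
    fix x y and p q :: real assume xy: "x \<in> T" "y \<in> T" and pq: "p + q = 1"
    obtain c d where cd: "x - f x = c *\<^sub>R (b - a)" "y - f y = d *\<^sub>R (b - a)"
      using xy by (auto simp: T_def)
    have "f (p *\<^sub>R x + q *\<^sub>R y) = p *\<^sub>R g x + q *\<^sub>R g y + (p + q) *\<^sub>R t"
      using g(3)[of "p *\<^sub>R x + q *\<^sub>R y"] pq by (simp add: linear_add[OF g(1)] linear_cmul[OF g(1)])
    also have "\<dots> = p *\<^sub>R f x + q *\<^sub>R f y"
      using g(3)[of x] g(3)[of y] by (simp add: algebra_simps)
    finally have "(p *\<^sub>R x + q *\<^sub>R y) - f (p *\<^sub>R x + q *\<^sub>R y) = p *\<^sub>R (x - f x) + q *\<^sub>R (y - f y)"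
      by (simp add: algebra_simps)
    also have "\<dots> = (p * c + q * d) *\<^sub>R (b - a)"
      by (simp add: cd algebra_simps)
    finally show "p *\<^sub>R x + q *\<^sub>R y \<in> T" by (auto simp: T_def)
  qed
  have FT: "F (Suc k) \<subseteq> T" if "int (Suc k) \<le> aff_dim P" for k
    using that
  proof (induction k)
    case 0
    have "a - f a = (-1) *\<^sub>R (b - a)" "b - f b = 1 *\<^sub>R (b - a)" using f by auto
    then have "a \<in> T" "b \<in> T" unfolding T_def by blast+
    then show ?case
      using F(2) closed_segment_subset[OF _ _ affine_imp_convex[OF \<open>affine T\<close>]] by simp
  next
    case (Suc k)
    let ?G = "F (Suc k)" and ?H = "F (Suc (Suc k))"
    have IH: "?G \<subseteq> T" using Suc by simp
    have G: "?G face_of P" "aff_dim ?G = int (Suc k)"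
      and H: "?H face_of P" "aff_dim ?H = int (Suc (Suc k))" and GH: "?G \<subseteq> ?H"
      using F(1) Suc.prems unfolding flag_of_def by auto
    have polH: "polytope ?H" using face_of_polytope_polytope[OF pol H(1)] .
    have neH: "?H \<noteq> {}" and neG: "?G \<noteq> {}" using G(2) H(2) by auto
    have faceGH: "?G face_of ?H"
      using G(1) GH face_of_imp_subset[OF H(1)] face_of_subset by blast
    let ?c = "barycenter ?H"
    have "symmetry_of f ?H"
      using Fi[of "Suc (Suc k)"] Suc.prems f(1) by (simp add: symmetry_of_def)
    then have "f ?c = ?c" using symmetry_of_barycenter polH neH by blast
    then have "?c - f ?c = 0 *\<^sub>R (b - a)" by simp
    then have cT: "?c \<in> T" unfolding T_def by blast
    have cH: "?c \<in> ?H" using barycenter_in_polytope polH neH by blast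
    have "?c \<notin> affine hull ?G"
    proof
      assume "?c \<in> affine hull ?G"
      then have "?c \<in> ?G"
        using face_of_imp_eq_affine_Int[OF polytope_imp_convex[OF polH] faceGH] cH by blast
      then have "?G = ?H" using face_containing_barycenter polH faceGH by blast
      then show False using G(2) H(2) by simp
    qed
    then have "aff_dim (affine hull (insert ?c ?G)) = aff_dim (affine hull ?H)"
      using aff_dim_insert[of ?c ?G] G(2) H(2) by simp
    moreover have "affine hull (insert ?c ?G) \<subseteq> affine hull ?H"
      using cH GH by (intro hull_mono) auto
    ultimately have "affine hull (insert ?c ?G) = affine hull ?H"
      by (intro affine_dim_equal) auto
    moreover have "affine hull (insert ?c ?G) \<subseteq> T"
      using cT IH \<open>affine T\<close> by (intro hull_minimal) auto
    ultimately show ?case using hull_subset[of ?H affine] by (metis subset_trans)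
  qed
  obtain k where k: "DIM('a) = Suc k" using DIM_positive gr0_implies_Suc by blast
  have "aff_dim (F (Suc k)) = int DIM('a)"
    using F(1) assms(2) k unfolding flag_of_def by simp
  then have "affine hull (F (Suc k)) = UNIV" using aff_dim_eq_full by blast
  moreover have "affine hull (F (Suc k)) \<subseteq> T"
    using FT[of k] assms(2) k \<open>affine T\<close> by (intro hull_minimal) auto
  ultimately have "x \<in> T" for x by blast
  then have "f x = bisector_reflection a b x" for x
    using swapping_isometry_eq_bisector_reflection[OF iso f(2,3) edge_endpoints(3)[OF assms(3)]]
    unfolding T_def by blast
  then have "f = bisector_reflection a b" by blast
  then show ?thesis using f(1) by simp
qed

section \<open>Neighbours closer to a given vertex\<close>

text \<open>
  A single pivot of the simplex algorithm. Let \<open>h\<close> be a functional whose only maximum on \<open>P\<close> is at \<open>a\<close>. Among the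
  other vertices choose \<open>x0\<close> with the greatest slope, the gain in \<open>g\<close> per loss in \<open>h\<close>. Then adding this
  slope times \<open>h\<close> to \<open>g\<close> gives a functional that is maximal on a face containing \<open>a\<close> and \<open>x0\<close>, and on
  that face every point other than \<open>a\<close> improves \<open>g\<close>. Any edge of the face at \<open>a\<close> will do.
\<close>
lemma improving_edge:
  assumes "polytope P" "a \<in> vertices_of P" "b \<in> P" "g \<bullet> a < g \<bullet> b"
  obtains a' where "closed_segment a a' edge_of P" "g \<bullet> a < g \<bullet> a'"
proof -
  have V: "finite (vertices_of P)" "P = convex hull vertices_of P"
    using polytope_vertices[OF assms(1)] by blast+
  have "{a} face_of P" using assms(2) by (simp add: vertices_of_def face_of_singleton)
  then obtain h \<beta> where h: "P \<subseteq> {x. h \<bullet> x \<le> \<beta>}" "{a} = P \<inter> {x. h \<bullet> x = \<beta>}"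
    using exposed_face_of_polyhedron[OF polytope_imp_polyhedron[OF assms(1)]]
    unfolding exposed_face_of_def by metis
  have ha: "h \<bullet> a = \<beta>" "a \<in> P" using h(2) by auto
  have lt: "h \<bullet> x < h \<bullet> a" if "x \<in> P" "x \<noteq> a" for x
    using h ha(1) that by (metis (mono_tags, lifting) IntI mem_Collect_eq order_le_less singletonD subsetD)
  define W where "W = vertices_of P - {a}"
  have WP: "W \<subseteq> P" unfolding W_def vertices_of_def extreme_point_of_def by blast
  have finW: "finite W" using V(1) by (simp add: W_def)
  have "\<exists>x\<in>W. g \<bullet> a < g \<bullet> x"
  proof (rule ccontr)
    assume "\<not> ?thesis"
    then have "vertices_of P \<subseteq> {x. g \<bullet> x \<le> g \<bullet> a}" unfolding W_def by force
    then have "convex hull vertices_of P \<subseteq> {x. g \<bullet> x \<le> g \<bullet> a}"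
      by (intro hull_minimal convex_halfspace_le)
    then show False using assms(3,4) V(2) by auto
  qed
  then obtain x1 where x1: "x1 \<in> W" "g \<bullet> a < g \<bullet> x1" by blast
  define \<rho> where "\<rho> x = (g \<bullet> x - g \<bullet> a) / (h \<bullet> a - h \<bullet> x)" for x
  have "Max (\<rho> ` W) \<in> \<rho> ` W" using finW x1(1) by (intro Max_in) auto
  then obtain x0 where "x0 \<in> W" "\<rho> x0 = Max (\<rho> ` W)" by (metis imageE)
  then have x0: "x0 \<in> W" "\<And>x. x \<in> W \<Longrightarrow> \<rho> x \<le> \<rho> x0" using finW by auto
  have ltW: "h \<bullet> x < h \<bullet> a" if "x \<in> W" for x
    using lt[of x] that WP by (auto simp: W_def)
  have pos: "\<rho> x0 > 0"
  proof -
    have "\<rho> x1 > 0" using ltW[OF x1(1)] x1(2) by (simp add: \<rho>_def)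
    then show ?thesis using x0(2)[OF x1(1)] by simp
  qed
  define k where "k = g + \<rho> x0 *\<^sub>R h"
  have k_le: "k \<bullet> x \<le> k \<bullet> a" if "x \<in> vertices_of P" for x
  proof (cases "x = a")
    case False
    then have "x \<in> W" using that by (simp add: W_def)
    then have "g \<bullet> x - g \<bullet> a \<le> \<rho> x0 * (h \<bullet> a - h \<bullet> x)"
      using x0(2)[of x] ltW[of x] by (simp add: \<rho>_def[of x] pos_divide_le_eq)
    then show ?thesis by (simp add: k_def algebra_simps)
  qed simp
  have kP: "k \<bullet> x \<le> k \<bullet> a" if "x \<in> P" for x
  proof -
    have "convex hull vertices_of P \<subseteq> {x. k \<bullet> x \<le> k \<bullet> a}"
      using k_le by (intro hull_minimal convex_halfspace_le) auto
    then show ?thesis using that V(2) by auto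
  qed
  define F where "F = P \<inter> {x. k \<bullet> x = k \<bullet> a}"
  have F: "F face_of P"
    unfolding F_def using kP polytope_imp_convex[OF assms(1)]
    by (intro face_of_Int_supporting_hyperplane_le) auto
  have polF: "polytope F" using face_of_polytope_polytope[OF assms(1) F] .
  have aF: "a \<in> vertices_of F"
    using extreme_point_of_face[OF F] assms(2) ha(2) by (auto simp: vertices_of_def F_def)
  have "g \<bullet> x0 - g \<bullet> a = \<rho> x0 * (h \<bullet> a - h \<bullet> x0)"
    using ltW[OF x0(1)] by (simp add: \<rho>_def)
  then have "x0 \<in> F" using x0(1) WP by (auto simp: F_def k_def algebra_simps)
  moreover have "x0 \<noteq> a" "a \<in> F" using x0(1) ha(2) by (auto simp: W_def F_def)
  ultimately have "aff_dim F \<ge> 1"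
    using aff_dim_subset[of "{a, x0}" F] by (simp add: aff_dim_2)
  then obtain a' where e: "closed_segment a a' edge_of F"
    using edge_at_vertex[OF polF aF] by blast
  then have eP: "closed_segment a a' edge_of P"
    using F face_of_trans unfolding edge_of_def by blast
  have "a' \<in> F" "a' \<noteq> a"
    using edge_endpoints[OF e] by (auto simp: vertices_of_def extreme_point_of_def)
  then have "h \<bullet> a' < h \<bullet> a" "g \<bullet> a' - g \<bullet> a = \<rho> x0 * (h \<bullet> a - h \<bullet> a')"
    using lt by (auto simp: F_def k_def algebra_simps)
  then have "g \<bullet> a < g \<bullet> a'" using pos by (smt (verit) mult_pos_pos)
  then show thesis using that eP by blast
qed

text \<open>
  Flag transitivity makes the symmetries transitive on vertices, and all of them fix the barycenter.
\<close>
lemma regular_polytope_vertices_equidistant: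
  fixes P :: "'a::euclidean_space set"
  assumes "regular_polytope P" "aff_dim P \<ge> 1" "a \<in> vertices_of P" "b \<in> vertices_of P"
  shows "dist (barycenter P) a = dist (barycenter P) b"
proof -
  have pol: "polytope P" using assms(1) by (simp add: regular_polytope_def)
  have flag: "\<exists>F. flag_of F P \<and> F 0 = {c}" if c: "c \<in> vertices_of P" for c
  proof -
    obtain d where "closed_segment c d edge_of P" using edge_at_vertex[OF pol c assms(2)] by blast
    then obtain F where "flag_of (F(0 := {c})) P" using flag_through_edge[OF pol] by blast
    then show ?thesis by (intro exI[of _ "F(0 := {c})"]) simp
  qed
  obtain F G where "flag_of F P" "F 0 = {a}" "flag_of G P" "G 0 = {b}"
    using flag assms(3,4) by meson
  then obtain f where f: "symmetry_of f P" "f ` {a} = {b}"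
    using assms(1,2) unfolding regular_polytope_def by (metis of_nat_0 order_trans zero_le_one)
  have "f (barycenter P) = barycenter P"
    using symmetry_of_barycenter[OF f(1) pol] assms(3)
    by (auto simp: vertices_of_def extreme_point_of_def)
  moreover have "dist (f (barycenter P)) (f a) = dist (barycenter P) a"
    using f(1) by (simp add: symmetry_of_def)
  ultimately show ?thesis using f(2) by simp
qed

text \<open>
  On a sphere around \<open>c\<close>, the squared distance to \<open>b\<close> is a decreasing affine function of the inner product
  with \<open>b - c\<close>, so an edge that improves this functional leads closer to \<open>b\<close>.
\<close>
lemma closer_neighbour:
  fixes P :: "'a::euclidean_space set"
  assumes "regular_polytope P" "aff_dim P \<ge> 1" "a \<in> vertices_of P" "b \<in> vertices_of P" "a \<noteq> b"
  obtains a' where "closed_segment a a' edge_of P" "dist a' b < dist a b"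
proof -
  have pol: "polytope P" using assms(1) by (simp add: regular_polytope_def)
  define c where "c = barycenter P"
  have eq: "(x - c) \<bullet> (x - c) = (b - c) \<bullet> (b - c)" if "x \<in> vertices_of P" for x
    using regular_polytope_vertices_equidistant[OF assms(1,2) that assms(4)]
    by (simp add: c_def dist_norm norm_eq norm_minus_commute)
  have sq: "(x - b) \<bullet> (x - b) = 2 * ((b - c) \<bullet> b) - 2 * ((b - c) \<bullet> x)" if "x \<in> vertices_of P" for x
    using eq[OF that] by (simp add: algebra_simps inner_commute)
  have "(a - b) \<bullet> (a - b) > 0" using assms(5) by simp
  then have "(b - c) \<bullet> a < (b - c) \<bullet> b" using sq[OF assms(3)] by simp
  moreover have "b \<in> P" using assms(4) by (simp add: vertices_of_def extreme_point_of_def)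
  ultimately obtain a' where a': "closed_segment a a' edge_of P" "(b - c) \<bullet> a < (b - c) \<bullet> a'"
    using improving_edge[OF pol assms(3)] by blast
  have "(a' - b) \<bullet> (a' - b) < (a - b) \<bullet> (a - b)"
    using sq[OF assms(3)] sq[OF edge_endpoints(2)[OF a'(1)]] a'(2) by simp
  then have "dist a' b < dist a b" by (simp add: dist_norm norm_lt)
  then show thesis using that a'(1) by blast
qed

text \<open>
  In a pair of vertices at minimal distance, the closer neighbour of the first one can only be the second
  one; hence the pair spans an edge.
\<close>
lemma edge_length_le_vertex_dist:
  fixes P :: "'a::euclidean_space set"
  assumes "regular_polytope P" "aff_dim P \<ge> 1" "edge_length P l"
    "a \<in> vertices_of P" "b \<in> vertices_of P" "a \<noteq> b"
  shows "l \<le> dist a b"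
proof -
  let ?S = "{p \<in> vertices_of P \<times> vertices_of P. fst p \<noteq> snd p}"
  have "finite (vertices_of P)"
    using assms(1) polytope_vertices(1) by (auto simp: regular_polytope_def)
  then have "finite ?S" by auto
  moreover have "(a, b) \<in> ?S" using assms by auto
  ultimately obtain p where p: "p \<in> ?S" "\<And>q. q \<in> ?S \<Longrightarrow> dist (fst p) (snd p) \<le> dist (fst q) (snd q)"
    using arg_min_if_finite[of ?S "\<lambda>p. dist (fst p) (snd p)"] by (metis (no_types, lifting) empty_iff not_le)
  obtain x y where xy: "p = (x, y)" by (cases p)
  have v: "x \<in> vertices_of P" "y \<in> vertices_of P" "x \<noteq> y" using p(1) xy by auto
  obtain x' where x': "closed_segment x x' edge_of P" "dist x' y < dist x y"
    using closer_neighbour[OF assms(1,2) v] by blast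
  have "x' = y"
  proof (rule ccontr)
    assume "x' \<noteq> y"
    then show False using p(2)[of "(x', y)"] xy v(2) x'(2) edge_endpoints(2)[OF x'(1)] by auto
  qed
  then have "dist x y = l" using x'(1) assms(3) by (simp add: edge_length_def)
  then show ?thesis using p(2)[OF \<open>(a, b) \<in> ?S\<close>] xy by simp
qed

section \<open>Widths and separation along edge directions\<close>

lemma inner_diff_midpoint: "(x - midpoint a b) \<bullet> (b - a) = (x - a) \<bullet> (b - a) - (norm (b - a))\<^sup>2 / 2"
  by (simp add: inner_diff_left[of x] inner_midpoint power2_norm_eq_inner)
     (simp add: field_simps inner_diff_left inner_diff_right inner_commute)

lemma bisector_reflection_inner:
  assumes "a \<noteq> b"
  shows "(bisector_reflection a b x - midpoint a b) \<bullet> (b - a) = - ((x - midpoint a b) \<bullet> (b - a))"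
proof -
  let ?h = "(x - midpoint a b) \<bullet> (b - a)"
  have "bisector_reflection a b x - midpoint a b =
    (x - midpoint a b) - (2 * ?h / (norm (b - a))\<^sup>2) *\<^sub>R (b - a)"
    by (simp add: bisector_reflection_def)
  then have "(bisector_reflection a b x - midpoint a b) \<bullet> (b - a) =
    ?h - (2 * ?h / (norm (b - a))\<^sup>2) * (norm (b - a))\<^sup>2"
    by (simp only: inner_diff_left[of "x - midpoint a b"] inner_scaleR_left power2_norm_eq_inner)
  also have "\<dots> = - ?h" using assms by simp
  finally show ?thesis .
qed

lemma diff_bisector_reflection:
  "x - bisector_reflection a b x = (2 * ((x - midpoint a b) \<bullet> (b - a)) / (norm (b - a))\<^sup>2) *\<^sub>R (b - a)"
  by (simp add: bisector_reflection_def)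

lemma norm_diff_bisector_reflection:
  assumes "a \<noteq> b"
  shows "norm (x - bisector_reflection a b x) * norm (b - a) = 2 * \<bar>(x - midpoint a b) \<bullet> (b - a)\<bar>"
  using assms by (simp add: diff_bisector_reflection power2_eq_square)

lemma norm_edge_vector:
  assumes "edge_length P l" "closed_segment a b edge_of P"
  shows "norm (b - a) = l"
  using assms unfolding edge_length_def by (metis dist_norm norm_minus_commute)

text \<open>
  The vertex \<open>b\<close> and its mirror image in the bisector of \<open>a a'\<close> are distinct vertices, so their distance is
  at least \<open>l\<close>; half of it separates \<open>b\<close> from the bisector, and the bisector is
  \<open>l / 2\<close> away from \<open>a\<close>.
\<close>
lemma edge_separating_vertices:
  fixes P :: "'a::euclidean_space set"
  assumes "regular_polytope P" "aff_dim P = int DIM('a)" "edge_length P l"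
    "a \<in> vertices_of P" "b \<in> vertices_of P" "a \<noteq> b"
  obtains a' where "closed_segment a a' edge_of P" "l\<^sup>2 \<le> (b - a) \<bullet> (a' - a)"
proof -
  have dim: "aff_dim P \<ge> 1" using assms(2) DIM_positive[where 'a='a] by simp
  obtain a' where a': "closed_segment a a' edge_of P" "dist a' b < dist a b"
    using closer_neighbour[OF assms(1) dim assms(4-6)] by blast
  have ne: "a \<noteq> a'" and l: "norm (a' - a) = l"
    using edge_endpoints[OF a'(1)] norm_edge_vector[OF assms(3) a'(1)] by auto
  let ?h = "(b - midpoint a a') \<bullet> (a' - a)" and ?b' = "bisector_reflection a a' b"
  have "(a' - b) \<bullet> (a' - b) < (a - b) \<bullet> (a - b)" using a'(2) by (simp add: dist_norm norm_lt)
  then have h: "?h > 0"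
    by (simp add: inner_diff_left[of b] inner_midpoint) (simp add: algebra_simps inner_commute)
  have "?b' \<in> vertices_of P"
    using symmetry_of_vertices(1)[OF edge_bisector_reflection_symmetry[OF assms(1,2) a'(1)]] assms(5) by blast
  moreover have "b \<noteq> ?b'"
    using norm_diff_bisector_reflection[OF ne, of b] h by auto
  ultimately have "l \<le> norm (b - ?b')"
    using edge_length_le_vertex_dist[OF assms(1) dim assms(3,5)] by (simp add: dist_norm)
  then have "l * l \<le> norm (b - ?b') * l" using l by (intro mult_right_mono) auto
  also have "\<dots> = 2 * ?h" using norm_diff_bisector_reflection[OF ne, of b] l h by simp
  finally have "l\<^sup>2 \<le> (b - a) \<bullet> (a' - a)"
    using inner_diff_midpoint[of b a a'] l by (simp add: power2_eq_square)
  then show thesis using that a'(1) by blast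
qed

lemma finite_parallel_lengths:
  assumes "polytope P"
  shows "finite {norm u | u. u \<in> vertex_vectors P \<and> (\<exists>v \<in> edge_vectors P. parallel u v)}" (is "finite ?D")
proof -
  have "?D \<subseteq> norm ` (\<lambda>(a, b). b - a) ` (vertices_of P \<times> vertices_of P)"
    by (force simp: vertex_vectors_def image_iff)
  then show ?thesis using polytope_vertices(1)[OF assms] by (elim finite_subset) simp
qed

text \<open>
  By the reflection symmetry, \<open>P\<close> extends equally far on both sides of the bisector of the edge. Its width is
  therefore the distance from an extremal vertex to its mirror image, and the vector between them takes
  part in the maximum that defines \<open>delta_par P\<close>.
\<close>
lemma edge_vector_width:
  fixes P :: "'a::euclidean_space set"
  assumes "regular_polytope P" "aff_dim P = int DIM('a)" "closed_segment a a' edge_of P"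
    "p \<in> P" "q \<in> P"
  shows "(p - q) \<bullet> (a' - a) \<le> delta_par P * norm (a' - a)"
proof -
  have pol: "polytope P" using assms(1) by (simp add: regular_polytope_def)
  have ne: "a \<noteq> a'" using edge_endpoints[OF assms(3)] by simp
  have V: "finite (vertices_of P)" "P = convex hull vertices_of P"
    using polytope_vertices[OF pol] by blast+
  let ?s = "bisector_reflection a a'"
  define h where "h x = (x - midpoint a a') \<bullet> (a' - a)" for x
  have h_le: "h y \<le> h x \<longleftrightarrow> (a' - a) \<bullet> y \<le> (a' - a) \<bullet> x" for x y
    by (simp add: h_def inner_diff_left[of _ "midpoint a a'"] inner_commute[of "a' - a"])
  have sym: "symmetry_of ?s P" by (rule edge_bisector_reflection_symmetry[OF assms(1-3)])
  have "Max (h ` vertices_of P) \<in> h ` vertices_of P"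
    using V(1) edge_endpoints(1)[OF assms(3)] by (intro Max_in) auto
  then obtain x where "x \<in> vertices_of P" "h x = Max (h ` vertices_of P)" by (metis imageE)
  then have x: "x \<in> vertices_of P" "\<And>y. y \<in> vertices_of P \<Longrightarrow> h y \<le> h x" using V(1) by auto
  have "vertices_of P \<subseteq> {y. (a' - a) \<bullet> y \<le> (a' - a) \<bullet> x}"
    using x(2) h_le by blast
  then have "P \<subseteq> {y. (a' - a) \<bullet> y \<le> (a' - a) \<bullet> x}"
    by (subst V(2)) (intro hull_minimal convex_halfspace_le)
  then have hx: "h y \<le> h x" if "y \<in> P" for y
    using that h_le by blast
  have "(a' - a) \<bullet> (a' - a) > 0" using ne by simp
  then have "h a' > 0"
    unfolding h_def inner_diff_midpoint power2_norm_eq_inner by linarith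
  then have pos: "h x > 0" using x(2)[OF edge_endpoints(2)[OF assms(3)]] by simp
  have "?s q \<in> P" using sym assms(5) by (auto simp: symmetry_of_def)
  then have "h p - h q \<le> 2 * h x"
    using hx[OF assms(4)] hx[of "?s q"] bisector_reflection_inner[OF ne, of q] by (simp add: h_def)
  moreover have "(p - q) \<bullet> (a' - a) = h p - h q" by (simp add: h_def algebra_simps)
  moreover have "2 * h x = norm (x - ?s x) * norm (a' - a)"
    using norm_diff_bisector_reflection[OF ne, of x] pos by (simp add: h_def)
  moreover have "norm (x - ?s x) \<le> delta_par P"
    unfolding delta_par_def
  proof (rule Max_ge[OF finite_parallel_lengths[OF pol]])
    have "?s x \<in> vertices_of P" using symmetry_of_vertices(1)[OF sym] x(1) by blast
    moreover have "x \<noteq> ?s x" using norm_diff_bisector_reflection[OF ne, of x] pos by (auto simp: h_def)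
    ultimately have "x - ?s x \<in> vertex_vectors P" using x(1) unfolding vertex_vectors_def
      by (intro CollectI exI[of _ "?s x"] exI[of _ x]) auto
    moreover have "a' - a \<in> edge_vectors P"
      using edge_endpoints[OF assms(3)] assms(3) unfolding edge_vectors_def by blast
    moreover have "parallel (x - ?s x) (a' - a)"
      unfolding parallel_def using ne \<open>x \<noteq> ?s x\<close> diff_bisector_reflection[of x a a'] by auto
    ultimately show "norm (x - ?s x) \<in>
        {norm u | u. u \<in> vertex_vectors P \<and> (\<exists>v \<in> edge_vectors P. parallel u v)}"
      by blast
  qed
  ultimately show ?thesis
    by (smt (verit) mult_right_mono norm_ge_zero)
qed

lemma delta_par_attained:
  assumes "polytope P" "aff_dim P \<ge> 1" "edge_length P l"
  obtains a a' x y where "closed_segment a a' edge_of P" "x \<in> vertices_of P" "y \<in> vertices_of P"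
    "y - x = (delta_par P / l) *\<^sub>R (a' - a)" "0 < delta_par P" "0 < l"
proof -
  let ?D = "{norm u | u. u \<in> vertex_vectors P \<and> (\<exists>v \<in> edge_vectors P. parallel u v)}"
  have "P \<noteq> {}" using assms(2) by auto
  then obtain c where "c \<in> vertices_of P"
    using polytope_vertices_nonempty[OF assms(1)] by (metis card.empty equals0I less_irrefl)
  then obtain d where d: "closed_segment c d edge_of P" using edge_at_vertex[OF assms(1) _ assms(2)] by blast
  have "d - c \<in> edge_vectors P" "d - c \<in> vertex_vectors P"
    using edge_endpoints[OF d] d unfolding edge_vectors_def vertex_vectors_def by blast+
  moreover have "parallel (d - c) (d - c)"
    using edge_endpoints(3)[OF d] by (auto simp: parallel_def intro: exI[of _ 1])
  ultimately have "norm (d - c) \<in> ?D" by blast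
  then have "delta_par P \<in> ?D"
    unfolding delta_par_def using finite_parallel_lengths[OF assms(1)] by (intro Max_in) auto
  then obtain u w where u: "u \<in> vertex_vectors P" "w \<in> edge_vectors P" "parallel u w"
    "norm u = delta_par P" by auto
  obtain x y where xy: "u = y - x" "x \<in> vertices_of P" "y \<in> vertices_of P" "x \<noteq> y"
    using u(1) unfolding vertex_vectors_def by blast
  obtain a a' where a: "w = a' - a" "closed_segment a a' edge_of P"
    using u(2) unfolding edge_vectors_def by blast
  obtain k where k: "u = k *\<^sub>R w" using u(3) by (auto simp: parallel_def)
  have l: "norm w = l" using a norm_edge_vector[OF assms(3)] by blast
  have pos: "0 < delta_par P" "0 < l"
    unfolding u(4)[symmetric] l[symmetric] using u(3) by (auto simp: parallel_def)
  have kabs: "\<bar>k\<bar> = delta_par P / l" using u(4) k l pos by (simp add: field_simps)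
  show thesis
  proof (cases "k \<ge> 0")
    case True
    then show ?thesis using that[OF a(2) xy(2,3)] k kabs xy(1) a(1) pos by simp
  next
    case False
    then have "k = - (delta_par P / l)" using kabs by simp
    then have "y - x = (delta_par P / l) *\<^sub>R (a - a')"
      using k xy(1) a(1) by (simp add: algebra_simps)
    moreover have "closed_segment a' a edge_of P" using a(2) by (simp add: closed_segment_commute)
    ultimately show ?thesis using that[of a' a x y] xy(2,3) pos by blast
  qed
qed

section \<open>Regions of the chaos game\<close>

lemma chaos_map_eq_iff:
  assumes "r < 1"
  shows "chaos_map r a p = chaos_map r b q \<longleftrightarrow> p - q = (r / (1 - r)) *\<^sub>R (b - a)"
proof -
  have "chaos_map r a p = chaos_map r b q \<longleftrightarrow> (1 - r) *\<^sub>R (p - q) = r *\<^sub>R (b - a)"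
    by (auto simp: chaos_map_def algebra_simps)
  also have "\<dots> \<longleftrightarrow> (1 - r) *\<^sub>R (p - q) = (1 - r) *\<^sub>R ((r / (1 - r)) *\<^sub>R (b - a))"
    using assms by simp
  also have "\<dots> \<longleftrightarrow> p - q = (r / (1 - r)) *\<^sub>R (b - a)"
    using assms by (subst scaleR_cancel_left) simp
  finally show ?thesis .
qed

lemma interior_chaos_map_image:
  fixes P :: "'a::euclidean_space set"
  assumes "r < 1"
  shows "interior (chaos_map r a ` P) = chaos_map r a ` interior P"
proof
  have eq: "chaos_map r a = (\<lambda>x. r *\<^sub>R a + (1 - r) *\<^sub>R x)"
    by (simp add: fun_eq_iff chaos_map_def add.commute)
  have "inj (chaos_map r a)" using assms by (simp add: eq inj_on_def)
  moreover have "continuous_on UNIV (chaos_map r a)"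
    unfolding eq by (intro continuous_intros)
  ultimately show "interior (chaos_map r a ` P) \<subseteq> chaos_map r a ` interior P"
    by (intro interior_image_subset) (auto simp: continuous_on_eq_continuous_at)
  have "open (chaos_map r a ` interior P)"
    unfolding eq using assms by (intro open_affinity) auto
  then show "chaos_map r a ` interior P \<subseteq> interior (chaos_map r a ` P)"
    by (intro interior_maximal image_mono interior_subset)
qed

text \<open>
  Both bounds compare the components of \<open>p - q\<close> and of \<open>b - a\<close> along an edge that separates \<open>a\<close> from \<open>b\<close>. An interior
  point can still be moved a little along this edge, which makes the inequality strict.
\<close>
lemma vertex_vector_scaling_bound:
  fixes P :: "'a::euclidean_space set"
  assumes "regular_polytope P" "aff_dim P = int DIM('a)" "edge_length P l" "0 < l"
    "a \<in> vertices_of P" "b \<in> vertices_of P" "a \<noteq> b"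
    "p \<in> P" "q \<in> P" "p - q = s *\<^sub>R (b - a)" "0 \<le> s"
  shows "s * l \<le> delta_par P" "p \<in> interior P \<Longrightarrow> s * l < delta_par P"
proof -
  obtain a' where a': "closed_segment a a' edge_of P" "l\<^sup>2 \<le> (b - a) \<bullet> (a' - a)"
    using edge_separating_vertices[OF assms(1-3,5-7)] by blast
  have l: "norm (a' - a) = l"
    by (rule norm_edge_vector[OF assms(3) a'(1)])
  have "s * l\<^sup>2 \<le> s * ((b - a) \<bullet> (a' - a))"
    using a'(2) assms(11) by (intro mult_left_mono)
  then have low: "s * l * l \<le> (p - q) \<bullet> (a' - a)"
    by (simp add: assms(10) power2_eq_square mult.assoc)
  have "(p - q) \<bullet> (a' - a) \<le> delta_par P * l"
    using edge_vector_width[OF assms(1,2) a'(1) assms(8,9)] l by simp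
  then have "s * l * l \<le> delta_par P * l" using low by simp
  then show "s * l \<le> delta_par P" using \<open>0 < l\<close> by simp
  assume "p \<in> interior P"
  then obtain \<epsilon> where eps: "\<epsilon> > 0" "cball p \<epsilon> \<subseteq> P"
    by (auto simp: mem_interior_cball)
  have "p + (\<epsilon> / l) *\<^sub>R (a' - a) \<in> P"
    using eps \<open>0 < l\<close> l by (intro subsetD[OF eps(2)]) (simp add: dist_norm)
  then have "(p + (\<epsilon> / l) *\<^sub>R (a' - a) - q) \<bullet> (a' - a) \<le> delta_par P * l"
    using edge_vector_width[OF assms(1,2) a'(1) _ assms(9)] l by simp
  moreover have "(p + (\<epsilon> / l) *\<^sub>R (a' - a) - q) \<bullet> (a' - a) = (p - q) \<bullet> (a' - a) + (\<epsilon> / l) * l\<^sup>2"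
    using l by (simp add: inner_left_distrib inner_diff_left power2_norm_eq_inner flip: l)
  moreover have "(\<epsilon> / l) * l\<^sup>2 > 0" using eps(1) \<open>0 < l\<close> by simp
  ultimately have "s * l * l < delta_par P * l" using low by linarith
  then show "s * l < delta_par P" using \<open>0 < l\<close> by simp
qed

text \<open>
  Both endpoints of the chord are contracted by the same factor towards a common interior point.
\<close>
lemma proportional_interior_chord:
  fixes P :: "'a::euclidean_space set"
  assumes "convex P" "interior P \<noteq> {}" "x \<in> P" "y \<in> P" "0 \<le> s" "s < 1"
  obtains p q where "p \<in> interior P" "q \<in> interior P" "p - q = s *\<^sub>R (y - x)"
proof -
  obtain z where z: "z \<in> interior P" using assms(2) by blast
  show thesis
  proof
    show "y - (1 - s) *\<^sub>R (y - z) \<in> interior P" "x - (1 - s) *\<^sub>R (x - z) \<in> interior P"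
      using assms z by (auto intro!: mem_interior_convex_shrink)
    show "(y - (1 - s) *\<^sub>R (y - z)) - (x - (1 - s) *\<^sub>R (x - z)) = s *\<^sub>R (y - x)"
      by (simp add: algebra_simps)
  qed
qed

lemma touch_without_overlapping_iff:
  fixes P :: "'a::euclidean_space set" and v :: "'i \<Rightarrow> 'a"
  assumes "regular_polytope P" "aff_dim P = int DIM('a)" "edge_length P l"
    "bij_betw v I (vertices_of P)" "0 < r" "r < 1"
  shows "touch_without_overlapping I (\<lambda>i. chaos_map r (v i) ` P) \<longleftrightarrow> r / (1 - r) * l = delta_par P"
    (is "?touch \<longleftrightarrow> ?t * l = _")
proof -
  have pol: "polytope P" using assms(1) by (simp add: regular_polytope_def)
  have dim: "aff_dim P \<ge> 1" using assms(2) DIM_positive[where 'a='a] by simp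
  have t: "?t > 0" using assms(5,6) by simp
  obtain a a' x y where e: "closed_segment a a' edge_of P" and xy: "x \<in> vertices_of P" "y \<in> vertices_of P"
    "y - x = (delta_par P / l) *\<^sub>R (a' - a)" and pos: "0 < delta_par P" "0 < l"
    using delta_par_attained[OF pol dim assms(3)] by blast
  have xyP: "x \<in> P" "y \<in> P" using xy(1,2) by (auto simp: vertices_of_def extreme_point_of_def)
  obtain i0 j0 where ij: "i0 \<in> I" "j0 \<in> I" "v i0 = a" "v j0 = a'" "i0 \<noteq> j0"
    using assms(4) edge_endpoints[OF e] unfolding bij_betw_def by (metis imageE)
  have vert: "v i \<in> vertices_of P" "v j \<in> vertices_of P" "v i \<noteq> v j" if "i \<in> I" "j \<in> I" "i \<noteq> j" for i j
    using assms(4) that unfolding bij_betw_def inj_on_def by auto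
  have bound: "?t * l \<le> delta_par P" "p \<in> interior P \<Longrightarrow> ?t * l < delta_par P"
    if "i \<in> I" "j \<in> I" "i \<noteq> j" "p \<in> P" "q \<in> P" "chaos_map r (v i) p = chaos_map r (v j) q" for i j p q
    using vertex_vector_scaling_bound[OF assms(1-3) pos(2) vert[OF that(1-3)] that(4,5), of ?t]
      that(6) t chaos_map_eq_iff[OF assms(6)] by auto
  show ?thesis
  proof
    assume touch: ?touch
    then obtain i j where "i \<in> I" "j \<in> I" "i \<noteq> j"
      "chaos_map r (v i) ` P \<inter> chaos_map r (v j) ` P \<noteq> {}"
      unfolding touch_without_overlapping_def by blast
    then have le: "?t * l \<le> delta_par P" using bound(1) by blast
    show "?t * l = delta_par P"
    proof (rule ccontr)
      assume "?t * l \<noteq> delta_par P"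
      then have "?t * l < delta_par P" using le by linarith
      then have lt: "?t * l / delta_par P < 1" by (simp only: divide_less_eq_1_pos[OF pos(1)])
      have ge: "0 \<le> ?t * l / delta_par P" using assms(5,6) pos by (intro divide_nonneg_pos mult_nonneg_nonneg) auto
      have int: "interior P \<noteq> {}"
        using assms(2) xyP(1) interior_rel_interior_gen[of P]
          rel_interior_eq_empty[OF polytope_imp_convex[OF pol]] by auto
      then obtain p q where pq: "p \<in> interior P" "q \<in> interior P" "p - q = (?t * l / delta_par P) *\<^sub>R (y - x)"
        using proportional_interior_chord[OF polytope_imp_convex[OF pol] int xyP ge lt] by blast
      have "p - q = ?t *\<^sub>R (a' - a)" using pq(3) xy(3) pos by simp
      then have "chaos_map r a p = chaos_map r a' q" using chaos_map_eq_iff[OF assms(6)] by blast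
      moreover have "chaos_map r a p \<in> interior (chaos_map r a ` P)"
        using pq(1) interior_chaos_map_image[OF assms(6)] by blast
      moreover have "chaos_map r a' q \<in> chaos_map r a' ` P" using pq(2) interior_subset by blast
      ultimately have "chaos_map r (v j0) ` P \<inter> interior (chaos_map r (v i0) ` P) \<noteq> {}"
        using ij(3,4) by auto
      then show False using touch ij unfolding touch_without_overlapping_def by blast
    qed
  next
    assume eq: "?t * l = delta_par P"
    show ?touch
      unfolding touch_without_overlapping_def
    proof (intro conjI ballI impI)
      fix i j assume "i \<in> I" "j \<in> I" "i \<noteq> j"
      show "chaos_map r (v j) ` P \<inter> interior (chaos_map r (v i) ` P) = {}"
      proof (rule ccontr)
        assume "\<not> ?thesis"
        then obtain z where z: "z \<in> chaos_map r (v j) ` P" "z \<in> chaos_map r (v i) ` interior P"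
          unfolding interior_chaos_map_image[OF assms(6)] by blast
        obtain q where q: "q \<in> P" "z = chaos_map r (v j) q" using z(1) by (rule imageE)
        obtain p where p: "p \<in> interior P" "z = chaos_map r (v i) p" using z(2) by (rule imageE)
        have "chaos_map r (v i) p = chaos_map r (v j) q" using p(2) q(2) by simp
        moreover have "p \<in> P" using p(1) interior_subset by (rule subsetD[rotated])
        ultimately have "?t * l < delta_par P"
          using bound(2)[OF \<open>i \<in> I\<close> \<open>j \<in> I\<close> \<open>i \<noteq> j\<close>] p(1) q(1) by blast
        then show False using eq by simp
      qed
    next
      have "y - x = ?t *\<^sub>R (a' - a)" using xy(3) pos by (simp flip: eq)
      then have "chaos_map r (v i0) y = chaos_map r (v j0) x"
        using chaos_map_eq_iff[OF assms(6)] ij by blast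
      then have "chaos_map r (v i0) ` P \<inter> chaos_map r (v j0) ` P \<noteq> {}" using xyP by blast
      then show "\<exists>i\<in>I. \<exists>j\<in>I. i \<noteq> j \<and> chaos_map r (v i) ` P \<inter> chaos_map r (v j) ` P \<noteq> {}"
        using ij by blast
    qed
  qed
qed

theorem mainTheorem1:
  fixes P :: "'a::euclidean_space set" and V :: nat and v :: "nat \<Rightarrow> 'a" and l :: real
  assumes "regular_polytope P"
    and "aff_dim P = int DIM('a)"
    and "bij_betw v {1..V} (vertices_of P)"
    and "edge_length P l"
  shows "\<forall>r. is_optimal_ratio P {1..V} v r \<longleftrightarrow> r = delta_par P / (delta_par P + l)"
proof
  fix r
  have "polytope P" "aff_dim P \<ge> 1"
    using assms(1,2) DIM_positive[where 'a='a] by (auto simp: regular_polytope_def)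
  then have pos: "0 < delta_par P" "0 < l"
    using delta_par_attained[OF _ _ assms(4)] by metis+
  have "is_optimal_ratio P {1..V} v r \<longleftrightarrow> 0 < r \<and> r < 1 \<and> r / (1 - r) * l = delta_par P"
    using touch_without_overlapping_iff[OF assms(1,2,4,3)] by (auto simp: is_optimal_ratio_def)
  also have "\<dots> \<longleftrightarrow> r = delta_par P / (delta_par P + l)"
  proof
    assume "0 < r \<and> r < 1 \<and> r / (1 - r) * l = delta_par P"
    then have "r * l = delta_par P * (1 - r)" "r < 1" by (auto simp: field_simps)
    then show "r = delta_par P / (delta_par P + l)" using pos by (simp add: field_simps)
  next
    assume r: "r = delta_par P / (delta_par P + l)"
    then have "1 - r = l / (delta_par P + l)" using pos by (simp add: field_simps)
    then show "0 < r \<and> r < 1 \<and> r / (1 - r) * l = delta_par P"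
      using pos r by simp
  qed
  finally show "is_optimal_ratio P {1..V} v r \<longleftrightarrow> r = delta_par P / (delta_par P + l)" .
qed

end
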